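(* Let $n\ge1$ be an integer and let $x_i, v_i:\mathbb{R}\to\mathbb{R}^3$, $i=1,\ldots,n$, be a (global, continuously differentiable) solution of the repulsive $n$-body system $$\dot x_i = v_i,\qquad \dot v_i=\sum_{j=1,\ldots,n,\ j\neq i}\frac{x_i-x_j}{|x_i-x_j|^3},\qquad i=1,\ldots,n,$$ with $x_i(t)\neq x_j(t)$ for all $t\in\mathbb{R}$ and $i\neq j$. Let $E_{\mathrm{pot}}(t)$ be its potential energy (defined in the context). Then: (a) There is a constant $C>0$, independent of $t$, such that $E_{\mathrm{pot}}(t)\le C/t$ for all $t\ge1$. Moreover, there are constants $c_1,c_2>0$, depending only on the initial data of the solution, such that for all sufficiently large $t$, $$c_1t\le|x_i(t)-x_j(t)|\le c_2t\qquad\text{for all } i\neq j.$$ (b) For each $i=1,\ldots,n$ the limiting velocity $v_i^\ast=\lim_{t\to\infty}v_i(t)\in\mathbb{R}^3$ exists, and there is a constant $C>0$, independent of $t$, such that $|v_i(t)-v_i^\ast|\le C/t$ for all $t\ge1$ and all $i$. If $i\neq j$, then $v_i^\ast\neq v_j^\ast$. (c) In addition, there exist points $x_i^\ast\in\mathbb{R}^3$, $i=1,\ldots,n$, such that, with $v_i^\ast$ the limiting velocities from (b), $$x_i(t)=x_i^\ast+t\,v_i^\ast+\mathrm{O}(\ln t)\qquad\text{as }t\to\infty,\quad i=1,\ldots,n.$$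
   Context: The system describes $n$ point charges of equal sign, with unit charge and unit mass, positions $x_i(t)\in\mathbb{R}^3$ and velocities $v_i(t)\in\mathbb{R}^3$; $|\cdot|$ is the Euclidean norm. Every solution with initial positions that are pairwise distinct exists for all $t\in\mathbb{R}$, with positions remaining pairwise distinct. The initial data are the values $x_i(0),v_i(0)$, $i=1,\ldots,n$. Constants may depend on the given solution (including $n$) but not on $t$. The potential energy is $$E_{\mathrm{pot}}(t):=\frac12\sum_{1\le i\neq j\le n}\frac{1}{|x_i(t)-x_j(t)|},$$ where the sum is over ordered pairs $(i,j)$ with $i\neq j$ (an empty sum is $0$). *)

theory Defs
  imports "HOL-Analysis.Analysis" "HOL-Library.Landau_Symbols"
begin

text \<open>
  A configuration is given by functions \<open>x, v :: nat \<Rightarrow> real \<Rightarrow> real ^ 3\<close>, of which only the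
  indices in \<open>{1..n}\<close> matter. Continuity of the derivatives is not demanded separately:
  \<open>v i\<close> is differentiable, hence continuous, and in the absence of collisions
  the right-hand side of the equation for \<open>v i\<close> is then continuous as well.
\<close>

definition repulsive_force :: "nat \<Rightarrow> (nat \<Rightarrow> real \<Rightarrow> real ^ 3) \<Rightarrow> nat \<Rightarrow> real \<Rightarrow> real ^ 3" where
  "repulsive_force n x i t =
     (\<Sum>j\<in>{1..n} - {i}. (x i t - x j t) /\<^sub>R norm (x i t - x j t) ^ 3)"

definition nbody_solution ::
    "nat \<Rightarrow> (nat \<Rightarrow> real \<Rightarrow> real ^ 3) \<Rightarrow> (nat \<Rightarrow> real \<Rightarrow> real ^ 3) \<Rightarrow> bool" where
  "nbody_solution n x v \<longleftrightarrow>
     (\<forall>i\<in>{1..n}. \<forall>t. (x i has_vector_derivative v i t) (at t)) \<and>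
     (\<forall>i\<in>{1..n}. \<forall>t. (v i has_vector_derivative repulsive_force n x i t) (at t)) \<and>
     (\<forall>i\<in>{1..n}. \<forall>j\<in>{1..n}. i \<noteq> j \<longrightarrow> (\<forall>t. x i t \<noteq> x j t))"

definition same_initial_data ::
    "nat \<Rightarrow> (nat \<Rightarrow> real \<Rightarrow> real ^ 3) \<Rightarrow> (nat \<Rightarrow> real \<Rightarrow> real ^ 3) \<Rightarrow>
     (nat \<Rightarrow> real \<Rightarrow> real ^ 3) \<Rightarrow> (nat \<Rightarrow> real \<Rightarrow> real ^ 3) \<Rightarrow> bool" where
  "same_initial_data n x v y w \<longleftrightarrow> (\<forall>i\<in>{1..n}. y i 0 = x i 0 \<and> w i 0 = v i 0)"

definition E_pot :: "nat \<Rightarrow> (nat \<Rightarrow> real \<Rightarrow> real ^ 3) \<Rightarrow> real \<Rightarrow> real" where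
  "E_pot n x t = 1 / 2 * (\<Sum>i\<in>{1..n}. \<Sum>j\<in>{1..n} - {i}. 1 / norm (x i t - x j t))"

end

theory Submission
  imports Defs "HOL-Real_Asymp.Real_Asymp"
begin

text \<open>
  The solution disperses because of a pseudoconformal energy. Write \<open>s = t + 1\<close> and
  \<open>Q(t) = 1/2 (\<Sum>i. |x\<^sub>i - s v\<^sub>i|\<^sup>2) + s\<^sup>2 E_pot(t)\<close>. The force is homogeneous of degree
  \<open>-2\<close> and derives from \<open>E_pot\<close>, so in \<open>Q'\<close> every term containing the velocities cancels
  and only \<open>Q' = s E_pot\<close> is left (\<open>conformal_energy_deriv\<close>). Since \<open>s E_pot \<le> Q / s\<close>,
  the quotient \<open>Q / s\<close> decreases, and therefore \<open>E_pot(t) \<le> Q(0) / (t + 1)\<close>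
  (\<open>E_pot_decay\<close>). The shift by \<open>1\<close> makes \<open>Q(0)\<close> an expression in the initial data alone,
  so the constants derived from it are shared by all solutions with these data.

  The rest is integration. Each term of \<open>E_pot\<close> is bounded by the whole, so distances grow
  at least linearly and the forces are \<open>O(1 / s\<^sup>2)\<close>. One integration shows that the
  velocities form a Cauchy family, converging at the rate \<open>1 / s\<close>
  (\<open>velocity_converges\<close>); a second one gives \<open>x\<^sub>i(t) = x\<^sub>i(0) + t v\<^sub>i\<^sup>* + O(ln s)\<close>
  (\<open>position_asymptotics\<close>). Two equal limiting velocities would leave only a logarithmic
  growth of the distance, in contradiction to its linear lower bound.
\<close>

section \<open>The pseudoconformal energy\<close>

lemma sum_off_diagonal_swap:
  fixes f :: "'a \<Rightarrow> 'a \<Rightarrow> 'b::comm_monoid_add"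
  assumes "finite A"
  shows "(\<Sum>i\<in>A. \<Sum>j\<in>A - {i}. f i j) = (\<Sum>i\<in>A. \<Sum>j\<in>A - {i}. f j i)"
proof -
  have restrict: "(\<Sum>j\<in>A - {i}. g j) = (\<Sum>j\<in>A. if i = j then 0 else g j)"
    for i and g :: "'a \<Rightarrow> 'b"
    using assms by (intro sum.mono_neutral_cong_left) auto
  have "(\<Sum>i\<in>A. \<Sum>j\<in>A - {i}. f i j) = (\<Sum>j\<in>A. \<Sum>i\<in>A. if i = j then 0 else f i j)"
    unfolding restrict by (rule sum.swap)
  also have "\<dots> = (\<Sum>j\<in>A. \<Sum>i\<in>A - {j}. f i j)"
    unfolding restrict by (intro sum.cong refl) auto
  finally show ?thesis .
qed

text \<open>
  The forces between two particles are opposite, so the power that they exert along any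
  displacements \<open>a\<close> depends on the differences of \<open>a\<close> only. For \<open>a = x\<close> this is the virial
  identity, for \<open>a = v\<close> it is the rate of change of the potential energy.
\<close>

lemma sum_inner_repulsive_force:
  "(\<Sum>i\<in>{1..n}. a i \<bullet> repulsive_force n x i t) =
     1 / 2 * (\<Sum>i\<in>{1..n}. \<Sum>j\<in>{1..n} - {i}.
       ((a i - a j) \<bullet> (x i t - x j t)) / norm (x i t - x j t) ^ 3)"
proof -
  define f where "f i j = (a i \<bullet> (x i t - x j t)) / norm (x i t - x j t) ^ 3" for i j
  have "(\<Sum>i\<in>{1..n}. a i \<bullet> repulsive_force n x i t) = (\<Sum>i\<in>{1..n}. \<Sum>j\<in>{1..n} - {i}. f i j)"
    unfolding repulsive_force_def f_def inner_sum_right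
    by (intro sum.cong refl) (simp add: divide_inverse mult.commute)
  moreover have "\<dots> = (\<Sum>i\<in>{1..n}. \<Sum>j\<in>{1..n} - {i}. f j i)"
    by (rule sum_off_diagonal_swap) simp
  moreover have "((a i - a j) \<bullet> (x i t - x j t)) / norm (x i t - x j t) ^ 3 = f i j + f j i"
    for i j
    unfolding f_def norm_minus_commute[of "x j t"]
    by (simp add: inner_diff_left inner_diff_right diff_divide_distrib add_divide_distrib)
  ultimately show ?thesis
    by (simp add: sum.distrib)
qed

lemma virial_identity:
  assumes "nbody_solution n x v"
  shows "(\<Sum>i\<in>{1..n}. x i t \<bullet> repulsive_force n x i t) = E_pot n x t"
proof -
  have "((x i t - x j t) \<bullet> (x i t - x j t)) / norm (x i t - x j t) ^ 3
      = 1 / norm (x i t - x j t)"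
    if "i \<in> {1..n}" "j \<in> {1..n} - {i}" for i j
  proof -
    have "norm (x i t - x j t) \<noteq> 0"
      using assms that by (auto simp: nbody_solution_def)
    then show ?thesis
      by (simp add: dot_square_norm power2_eq_square power3_eq_cube)
  qed
  then show ?thesis
    unfolding sum_inner_repulsive_force E_pot_def
    by (intro arg_cong[where f = "\<lambda>s. 1 / 2 * s"] sum.cong refl)
qed

lemma has_real_derivative_inverse_norm:
  fixes d :: "real \<Rightarrow> 'a::real_inner"
  assumes "(d has_vector_derivative d') (at t)" and "d t \<noteq> 0"
  shows "((\<lambda>t. 1 / norm (d t)) has_real_derivative - (d' \<bullet> d t) / norm (d t) ^ 3) (at t)"
proof -
  define q where "q t = d t \<bullet> d t" for t
  have "(q has_real_derivative 2 * (d' \<bullet> d t)) (at t)"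
    using assms(1) unfolding has_field_derivative_def has_vector_derivative_def q_def[abs_def]
    by (auto intro!: derivative_eq_intros simp: inner_commute algebra_simps)
  moreover have "q t > 0"
    using assms(2) by (simp add: q_def)
  ultimately have "((\<lambda>t. 1 / sqrt (q t)) has_real_derivative - (d' \<bullet> d t) / sqrt (q t) ^ 3) (at t)"
    by (auto intro!: derivative_eq_intros simp: field_simps power2_eq_square power3_eq_cube)
  then show ?thesis
    by (simp add: q_def norm_eq_sqrt_inner)
qed

lemma E_pot_deriv:
  assumes "nbody_solution n x v"
  shows "(E_pot n x has_real_derivative
      - (\<Sum>i\<in>{1..n}. v i t \<bullet> repulsive_force n x i t)) (at t)"
proof -
  have "((\<lambda>t. 1 / norm (x i t - x j t)) has_real_derivative
      - ((v i t - v j t) \<bullet> (x i t - x j t)) / norm (x i t - x j t) ^ 3) (at t)"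
    if "i \<in> {1..n}" "j \<in> {1..n} - {i}" for i j
    using assms that
    by (intro has_real_derivative_inverse_norm has_vector_derivative_diff)
       (auto simp: nbody_solution_def)
  then have "((\<lambda>t. 1 / 2 * (\<Sum>i\<in>{1..n}. \<Sum>j\<in>{1..n} - {i}. 1 / norm (x i t - x j t)))
      has_real_derivative 1 / 2 * (\<Sum>i\<in>{1..n}. \<Sum>j\<in>{1..n} - {i}.
        - ((v i t - v j t) \<bullet> (x i t - x j t)) / norm (x i t - x j t) ^ 3)) (at t)"
    by (intro DERIV_cmult DERIV_sum)
  then show ?thesis
    unfolding sum_inner_repulsive_force E_pot_def[abs_def] by (simp add: sum_negf)
qed

definition conformal_energy ::
    "nat \<Rightarrow> (nat \<Rightarrow> real \<Rightarrow> real ^ 3) \<Rightarrow> (nat \<Rightarrow> real \<Rightarrow> real ^ 3) \<Rightarrow> real \<Rightarrow> real" where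
  "conformal_energy n x v t =
     1 / 2 * (\<Sum>i\<in>{1..n}. (norm (x i t - (t + 1) *\<^sub>R v i t))\<^sup>2) + (t + 1)\<^sup>2 * E_pot n x t"

text \<open>
  Since \<open>x\<^sub>i - s v\<^sub>i\<close> has derivative \<open>- s F\<^sub>i\<close>, the first part of the energy contributes
  \<open>- s (\<Sum>i. x\<^sub>i \<bullet> F\<^sub>i) + s\<^sup>2 (\<Sum>i. v\<^sub>i \<bullet> F\<^sub>i)\<close>. The second sum cancels against \<open>s\<^sup>2 E_pot'\<close>,
  and by the virial identity the first takes away half of \<open>2 s E_pot\<close>.
\<close>

lemma conformal_energy_deriv:
  assumes "nbody_solution n x v"
  shows "(conformal_energy n x v has_real_derivative (t + 1) * E_pot n x t) (at t)"
proof -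
  define F where "F i = repulsive_force n x i t" for i
  define y where "y i t = x i t - (t + 1) *\<^sub>R v i t" for i t
  have dy2: "((\<lambda>t. (norm (y i t))\<^sup>2) has_real_derivative
      2 * (- (t + 1) * (x i t \<bullet> F i) + (t + 1)\<^sup>2 * (v i t \<bullet> F i))) (at t)"
    if "i \<in> {1..n}" for i
  proof -
    have "(x i has_vector_derivative v i t) (at t)" "(v i has_vector_derivative F i) (at t)"
      using assms that by (auto simp: nbody_solution_def F_def)
    then have "(y i has_vector_derivative - (t + 1) *\<^sub>R F i) (at t)"
      unfolding y_def[abs_def]
      by (auto intro!: derivative_eq_intros simp: algebra_simps)
    then have "((\<lambda>t. y i t \<bullet> y i t) has_real_derivative 2 * (y i t \<bullet> (- (t + 1) *\<^sub>R F i))) (at t)"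
      unfolding has_field_derivative_def has_vector_derivative_def
      by (auto intro!: derivative_eq_intros simp: inner_commute algebra_simps)
    moreover have "y i t \<bullet> (- (t + 1) *\<^sub>R F i)
        = - (t + 1) * (x i t \<bullet> F i) + (t + 1)\<^sup>2 * (v i t \<bullet> F i)"
      unfolding y_def inner_scaleR_right inner_diff_left inner_scaleR_left
      by (simp add: power2_eq_square algebra_simps)
    ultimately show ?thesis
      by (simp add: dot_square_norm)
  qed
  have s2: "((\<lambda>t. (t + 1)\<^sup>2) has_real_derivative 2 * (t + 1)) (at t)"
    by (auto intro!: derivative_eq_intros)
  have deriv: "((\<lambda>t. 1 / 2 * (\<Sum>i\<in>{1..n}. (norm (y i t))\<^sup>2) + (t + 1)\<^sup>2 * E_pot n x t)
      has_real_derivative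
      1 / 2 * (\<Sum>i\<in>{1..n}. 2 * (- (t + 1) * (x i t \<bullet> F i) + (t + 1)\<^sup>2 * (v i t \<bullet> F i)))
      + (2 * (t + 1) * E_pot n x t + - (\<Sum>i\<in>{1..n}. v i t \<bullet> F i) * (t + 1)\<^sup>2)) (at t)"
    unfolding F_def
    by (intro DERIV_add DERIV_cmult DERIV_sum DERIV_mult s2 E_pot_deriv[OF assms] dy2[unfolded F_def])
  have first_part:
    "1 / 2 * (\<Sum>i\<in>{1..n}. 2 * (- (t + 1) * (x i t \<bullet> F i) + (t + 1)\<^sup>2 * (v i t \<bullet> F i)))
      = - (t + 1) * (\<Sum>i\<in>{1..n}. x i t \<bullet> F i) + (t + 1)\<^sup>2 * (\<Sum>i\<in>{1..n}. v i t \<bullet> F i)"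
    unfolding sum_distrib_left sum.distrib[symmetric] by (intro sum.cong refl) simp
  have virial: "(\<Sum>i\<in>{1..n}. x i t \<bullet> F i) = E_pot n x t"
    unfolding F_def by (rule virial_identity[OF assms])
  show ?thesis
    using deriv unfolding first_part virial conformal_energy_def[abs_def] y_def
    by (rule DERIV_cong) (simp add: algebra_simps)
qed

lemma E_pot_decay:
  assumes sol: "nbody_solution n x v" and "t \<ge> 0"
  shows "E_pot n x t \<le> conformal_energy n x v 0 / (t + 1)"
proof -
  let ?Q = "conformal_energy n x v"
  have potential_le: "(\<tau> + 1)\<^sup>2 * E_pot n x \<tau> \<le> ?Q \<tau>" for \<tau>
    unfolding conformal_energy_def by (simp add: sum_nonneg)
  have "?Q t / (t + 1) \<le> ?Q 0 / (0 + 1)"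
  proof (rule DERIV_nonpos_imp_nonincreasing[OF \<open>t \<ge> 0\<close>])
    fix \<tau> :: real assume \<tau>: "0 \<le> \<tau>" "\<tau> \<le> t"
    have "((\<lambda>t. ?Q t / (t + 1)) has_real_derivative
        ((\<tau> + 1) * E_pot n x \<tau> * (\<tau> + 1) - ?Q \<tau> * 1) / ((\<tau> + 1) * (\<tau> + 1))) (at \<tau>)"
      using \<tau> by (intro DERIV_divide conformal_energy_deriv[OF sol])
        (auto intro!: derivative_eq_intros)
    moreover have "((\<tau> + 1) * E_pot n x \<tau> * (\<tau> + 1) - ?Q \<tau> * 1) / ((\<tau> + 1) * (\<tau> + 1)) \<le> 0"
      using potential_le[of \<tau>] \<tau>
      by (intro divide_nonpos_nonneg) (auto simp: power2_eq_square algebra_simps)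
    ultimately show "\<exists>y. ((\<lambda>t. ?Q t / (t + 1)) has_real_derivative y) (at \<tau>) \<and> y \<le> 0"
      by blast
  qed
  moreover have "(t + 1) * E_pot n x t \<le> ?Q t / (t + 1)"
    using potential_le[of t] \<open>t \<ge> 0\<close> by (simp add: field_simps power2_eq_square)
  ultimately have "(t + 1) * E_pot n x t \<le> ?Q 0"
    by simp
  then show ?thesis
    using \<open>t \<ge> 0\<close> by (simp add: pos_le_divide_eq mult.commute)
qed

section \<open>Distances and forces\<close>

text \<open>
  The energy vanishes for a single particle with \<open>x = v\<close> initially; adding \<open>1\<close> makes the
  constant positive in this case, too.
\<close>

definition dispersion_const ::
    "nat \<Rightarrow> (nat \<Rightarrow> real \<Rightarrow> real ^ 3) \<Rightarrow> (nat \<Rightarrow> real \<Rightarrow> real ^ 3) \<Rightarrow> real" where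
  "dispersion_const n x v = conformal_energy n x v 0 + 1"

lemma E_pot_nonneg: "E_pot n x t \<ge> 0"
  unfolding E_pot_def by (simp add: sum_nonneg)

lemma dispersion_const_pos: "dispersion_const n x v > 0"
proof -
  have "conformal_energy n x v 0 \<ge> 0"
    unfolding conformal_energy_def using E_pot_nonneg[of n x 0] by (simp add: sum_nonneg)
  then show ?thesis
    by (simp add: dispersion_const_def)
qed

lemma dispersion_const_cong:
  assumes "same_initial_data n x v y w"
  shows "dispersion_const n y w = dispersion_const n x v"
proof -
  have eq: "y i 0 = x i 0" "w i 0 = v i 0" if "i \<in> {1..n}" for i
    using assms that by (auto simp: same_initial_data_def)
  have "E_pot n y 0 = E_pot n x 0"
    unfolding E_pot_def
    by (intro arg_cong[where f = "\<lambda>s. 1 / 2 * s"] sum.cong refl) (simp add: eq)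
  moreover have "(\<Sum>i\<in>{1..n}. (norm (y i 0 - (0 + 1) *\<^sub>R w i 0))\<^sup>2)
      = (\<Sum>i\<in>{1..n}. (norm (x i 0 - (0 + 1) *\<^sub>R v i 0))\<^sup>2)"
    by (intro sum.cong refl) (simp add: eq)
  ultimately show ?thesis
    unfolding dispersion_const_def conformal_energy_def by (simp only:)
qed

lemma E_pot_decay':
  assumes "nbody_solution n x v" and "t \<ge> 0"
  shows "E_pot n x t \<le> dispersion_const n x v / (t + 1)"
  using E_pot_decay[OF assms] assms(2)
  by (auto simp: dispersion_const_def add_divide_distrib intro: order_trans)

text \<open>
  The factor \<open>1/2\<close> in the potential energy is made up for by the pair occurring in both orders.
\<close>

lemma inverse_distance_le_E_pot:
  assumes "i \<in> {1..n}" "j \<in> {1..n}" "i \<noteq> j"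
  shows "1 / norm (x i t - x j t) \<le> E_pot n x t"
proof -
  define g where "g i = (\<Sum>j\<in>{1..n} - {i}. 1 / norm (x i t - x j t))" for i
  have g0: "g k \<ge> 0" for k
    unfolding g_def by (simp add: sum_nonneg)
  have gi: "1 / norm (x i t - x j t) \<le> g i" and gj: "1 / norm (x j t - x i t) \<le> g j"
    unfolding g_def using assms
    by (auto intro!: member_le_sum[of _ _ "\<lambda>j. 1 / norm (x _ t - x j t)"])
  have "g i + g j = sum g {i, j}"
    using assms by simp
  also have "\<dots> \<le> sum g {1..n}"
    using assms g0 by (intro sum_mono2) auto
  finally show ?thesis
    using gi gj unfolding E_pot_def g_def by (simp add: norm_minus_commute)
qed

lemma inverse_distance_le:
  assumes "nbody_solution n x v" "t \<ge> 0" "i \<in> {1..n}" "j \<in> {1..n}" "i \<noteq> j"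
  shows "1 / norm (x i t - x j t) \<le> dispersion_const n x v / (t + 1)"
  using inverse_distance_le_E_pot[OF assms(3-5)] E_pot_decay'[OF assms(1,2)] by (rule order_trans)

lemma distance_lower_bound:
  assumes "nbody_solution n x v" "t \<ge> 0" "i \<in> {1..n}" "j \<in> {1..n}" "i \<noteq> j"
  shows "1 / dispersion_const n x v * t \<le> norm (x i t - x j t)"
proof -
  have "norm (x i t - x j t) > 0"
    using assms by (auto simp: nbody_solution_def)
  then have "t + 1 \<le> dispersion_const n x v * norm (x i t - x j t)"
    using inverse_distance_le[OF assms] \<open>t \<ge> 0\<close> by (simp add: field_simps)
  then show ?thesis
    using dispersion_const_pos[of n x v] by (simp add: field_simps)
qed

definition force_const ::
    "nat \<Rightarrow> (nat \<Rightarrow> real \<Rightarrow> real ^ 3) \<Rightarrow> (nat \<Rightarrow> real \<Rightarrow> real ^ 3) \<Rightarrow> real" where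
  "force_const n x v = real n * (dispersion_const n x v)\<^sup>2"

lemma force_decay:
  assumes sol: "nbody_solution n x v" and "t \<ge> 0" "i \<in> {1..n}"
  shows "norm (repulsive_force n x i t) \<le> force_const n x v / (t + 1)\<^sup>2"
proof -
  have pair: "norm ((x i t - x j t) /\<^sub>R norm (x i t - x j t) ^ 3)
      \<le> (dispersion_const n x v / (t + 1))\<^sup>2" if j: "j \<in> {1..n} - {i}" for j
  proof -
    have "norm ((x i t - x j t) /\<^sub>R norm (x i t - x j t) ^ 3) = (1 / norm (x i t - x j t))\<^sup>2"
      by (cases "x i t = x j t") (simp_all add: power2_eq_square power3_eq_cube inverse_eq_divide)
    also have "\<dots> \<le> (dispersion_const n x v / (t + 1))\<^sup>2"
      using inverse_distance_le[OF sol \<open>t \<ge> 0\<close> \<open>i \<in> {1..n}\<close>, of j] j by (intro power_mono) auto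
    finally show ?thesis .
  qed
  have "norm (repulsive_force n x i t)
      \<le> real (card ({1..n} - {i})) * (dispersion_const n x v / (t + 1))\<^sup>2"
    unfolding repulsive_force_def by (rule sum_norm_bound) (rule pair)
  also have "\<dots> \<le> real n * (dispersion_const n x v / (t + 1))\<^sup>2"
    using card_mono[of "{1..n}" "{1..n} - {i}"] by (intro mult_right_mono) auto
  finally show ?thesis
    by (simp add: force_const_def power_divide)
qed

section \<open>Limiting velocities and asymptotics of the positions\<close>

lemma velocity_increment:
  assumes sol: "nbody_solution n x v" and "0 \<le> a" "a \<le> b" and i: "i \<in> {1..n}"
  shows "norm (v i b - v i a) \<le> force_const n x v / (a + 1) - force_const n x v / (b + 1)"
proof (cases "a = b")
  case False
  let ?K = "force_const n x v"
  have dv: "(v i has_vector_derivative repulsive_force n x i t) (at t)" for t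
    using sol i by (auto simp: nbody_solution_def)
  have dphi: "((\<lambda>t. - ?K / (t + 1)) has_vector_derivative ?K / (t + 1)\<^sup>2) (at t)"
    if "t \<ge> 0" for t
    unfolding has_real_derivative_iff_has_vector_derivative[symmetric] using that
    by (auto intro!: derivative_eq_intros simp: power2_eq_square)
  have "norm (v i b - v i a) \<le> - ?K / (b + 1) - - ?K / (a + 1)"
  proof (rule differentiable_bound_general[where \<phi> = "\<lambda>t. - ?K / (t + 1)" and \<phi>' = "\<lambda>t. ?K / (t + 1)\<^sup>2"])
    show "a < b" using False \<open>a \<le> b\<close> by simp
    show "continuous_on {a..b} (v i)"
      by (rule continuous_on_vector_derivative) (rule has_vector_derivative_at_within[OF dv])
    show "continuous_on {a..b} (\<lambda>t. - ?K / (t + 1))"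
      using \<open>0 \<le> a\<close> by (intro continuous_intros) auto
  qed (use dv dphi force_decay[OF sol _ i] \<open>0 \<le> a\<close> in auto)
  then show ?thesis by simp
qed simp

lemma force_const_nonneg: "force_const n x v \<ge> 0"
  by (simp add: force_const_def)

text \<open>
  The bound on the increments is the difference of two values of a function vanishing at
  infinity, so it provides both the Cauchy property and, for \<open>b \<rightarrow> \<infinity>\<close>, the rate.
\<close>

lemma velocity_converges:
  assumes sol: "nbody_solution n x v" and i: "i \<in> {1..n}"
  obtains u where "(v i \<longlongrightarrow> u) at_top"
    and "\<And>t. t \<ge> 0 \<Longrightarrow> norm (v i t - u) \<le> force_const n x v / (t + 1)"
proof -
  define K where "K = force_const n x v"
  have step: "norm (v i b - v i a) \<le> K / (a + 1)" if "0 \<le> a" "a \<le> b" for a b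
  proof -
    have "K / (b + 1) \<ge> 0"
      using that force_const_nonneg[of n x v] by (simp add: K_def)
    then show ?thesis
      using velocity_increment[OF sol that i] unfolding K_def by linarith
  qed
  have small: "((\<lambda>a. K / (a + 1)) \<longlongrightarrow> 0) at_top"
    by real_asymp
  have "Cauchy (\<lambda>k. v i (real k))"
  proof (rule CauchyI')
    fix e :: real assume "e > 0"
    have "(\<lambda>k. K / (real k + 1)) \<longlonglongrightarrow> 0"
      by real_asymp
    with \<open>e > 0\<close> have "\<forall>\<^sub>F k in sequentially. K / (real k + 1) < e"
      by (rule order_tendstoD(2)[rotated])
    then obtain M where M: "\<And>k. k \<ge> M \<Longrightarrow> K / (real k + 1) < e"
      by (auto simp: eventually_sequentially)
    show "\<exists>M. \<forall>m\<ge>M. \<forall>k>m. dist (v i (real m)) (v i (real k)) < e"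
    proof (intro exI[of _ M] allI impI)
      fix m k assume "M \<le> m" "m < k"
      have "dist (v i (real m)) (v i (real k)) \<le> K / (real m + 1)"
        using step[of "real m" "real k"] \<open>m < k\<close> by (simp add: dist_norm norm_minus_commute)
      also have "\<dots> < e"
        by (rule M) fact
      finally show "dist (v i (real m)) (v i (real k)) < e" .
    qed
  qed
  then obtain u where u: "(\<lambda>k. v i (real k)) \<longlonglongrightarrow> u"
    using Cauchy_convergent by (auto simp: convergent_def)
  have rate: "norm (v i t - u) \<le> K / (t + 1)" if "t \<ge> 0" for t
  proof (rule tendsto_upperbound)
    show "(\<lambda>k. norm (v i t - v i (real k))) \<longlonglongrightarrow> norm (v i t - u)"
      by (intro tendsto_intros u)
    have "\<forall>\<^sub>F k in sequentially. t \<le> real k"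
      by real_asymp
    then show "\<forall>\<^sub>F k in sequentially. norm (v i t - v i (real k)) \<le> K / (t + 1)"
      using step[OF that] unfolding norm_minus_commute[of "v i t"] by (rule eventually_mono)
  qed simp
  have "((\<lambda>t. v i t - u) \<longlongrightarrow> 0) at_top"
  proof (rule Lim_null_comparison[OF _ small])
    show "\<forall>\<^sub>F t in at_top. norm (v i t - u) \<le> K / (t + 1)"
      using eventually_ge_at_top[of 0] by eventually_elim (rule rate)
  qed
  then show thesis
    using that rate unfolding K_def using LIM_zero_cancel by blast
qed

lemma position_asymptotics:
  assumes sol: "nbody_solution n x v" and i: "i \<in> {1..n}" and "t \<ge> 0"
    and rate: "\<And>t. t \<ge> 0 \<Longrightarrow> norm (v i t - u) \<le> K / (t + 1)"
  shows "norm (x i t - (x i 0 + t *\<^sub>R u)) \<le> K * ln (t + 1)"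
proof (cases "t = 0")
  case False
  have dx: "((\<lambda>t. x i t - t *\<^sub>R u) has_vector_derivative v i t - u) (at t)" for t
  proof -
    have "(x i has_vector_derivative v i t) (at t)"
      using sol i by (auto simp: nbody_solution_def)
    then show ?thesis
      by (auto intro!: derivative_eq_intros)
  qed
  have dphi: "((\<lambda>t. K * ln (t + 1)) has_vector_derivative K / (t + 1)) (at t)" if "t \<ge> 0" for t
    unfolding has_real_derivative_iff_has_vector_derivative[symmetric] using that
    by (auto intro!: derivative_eq_intros)
  have "norm ((x i t - t *\<^sub>R u) - (x i 0 - 0 *\<^sub>R u)) \<le> K * ln (t + 1) - K * ln (0 + 1)"
  proof (rule differentiable_bound_general[where \<phi> = "\<lambda>t. K * ln (t + 1)" and \<phi>' = "\<lambda>t. K / (t + 1)"])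
    show "0 < t" using False \<open>t \<ge> 0\<close> by simp
    show "continuous_on {0..t} (\<lambda>t. x i t - t *\<^sub>R u)"
      by (rule continuous_on_vector_derivative) (rule has_vector_derivative_at_within[OF dx])
    show "continuous_on {0..t} (\<lambda>t. K * ln (t + 1))"
      by (intro continuous_intros) auto
  qed (use dx dphi rate in auto)
  then show ?thesis by (simp add: algebra_simps)
qed simp

text \<open>
  The force is integrable in time, so a velocity never exceeds its initial norm by more than a
  constant, and for \<open>t \<ge> 1\<close> the initial position is absorbed in the linear term. The constant
  sums over all particles so as to serve every pair and to involve initial data only.
\<close>

lemma distance_upper_bound:
  assumes sol: "nbody_solution n x v" and "t \<ge> 1" and ij: "i \<in> {1..n}" "j \<in> {1..n}"
  shows "norm (x i t - x j t) \<le>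
    2 * (force_const n x v + (\<Sum>k\<in>{1..n}. norm (x k 0) + norm (v k 0))) * t"
proof -
  let ?K = "force_const n x v" and ?S = "\<Sum>k\<in>{1..n}. norm (x k 0) + norm (v k 0)"
  have one: "norm (x k t) \<le> (?K + ?S) * t" if k: "k \<in> {1..n}" for k
  proof -
    let ?B = "?K + norm (v k 0)"
    have "norm (x k t - x k 0) \<le> ?B * norm (t - 0)"
    proof (rule differentiable_bound[of "{0..t}" "x k" "\<lambda>s h. h *\<^sub>R v k s"])
      fix s assume s: "s \<in> {0..t}"
      show "(x k has_derivative (\<lambda>h. h *\<^sub>R v k s)) (at s within {0..t})"
        using sol k
        by (auto simp: nbody_solution_def has_vector_derivative_def intro: has_derivative_at_withinI)
      have "norm (v k s - v k 0) \<le> ?K / (0 + 1) - ?K / (s + 1)"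
        using s by (intro velocity_increment[OF sol _ _ k]) auto
      also have "\<dots> \<le> ?K"
        using s force_const_nonneg[of n x v] by simp
      finally have "norm (v k s) \<le> ?B"
        using norm_triangle_sub[of "v k s" "v k 0"] by linarith
      then show "onorm (\<lambda>h. h *\<^sub>R v k s) \<le> ?B"
        by (intro onorm_le) (simp add: mult.commute mult_left_mono)
    qed (use \<open>t \<ge> 1\<close> in auto)
    then have "norm (x k t) \<le> norm (x k 0) * 1 + ?B * t"
      using norm_triangle_sub[of "x k t" "x k 0"] \<open>t \<ge> 1\<close> by simp
    also have "\<dots> \<le> norm (x k 0) * t + ?B * t"
      using \<open>t \<ge> 1\<close> by (intro add_right_mono mult_left_mono) auto
    also have "\<dots> = (?K + (norm (x k 0) + norm (v k 0))) * t"
      by (simp add: algebra_simps)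
    also have "\<dots> \<le> (?K + ?S) * t"
      using k \<open>t \<ge> 1\<close>
      by (intro mult_right_mono add_left_mono member_le_sum[of k]) auto
    finally show ?thesis .
  qed
  have "norm (x i t - x j t) \<le> norm (x i t) + norm (x j t)"
    by (rule norm_triangle_ineq4)
  also have "\<dots> \<le> 2 * (?K + ?S) * t"
    using one[OF ij(1)] one[OF ij(2)] by (simp add: algebra_simps)
  finally show ?thesis .
qed

text \<open>
  With equal limits the linear terms of the two expansions cancel in the difference of the
  positions, and a logarithm cannot keep up with the linear lower bound.
\<close>

lemma limiting_velocities_distinct:
  assumes sol: "nbody_solution n x v" and ij: "i \<in> {1..n}" "j \<in> {1..n}" "i \<noteq> j"
    and rate_i: "\<And>t. t \<ge> 0 \<Longrightarrow> norm (v i t - u) \<le> K / (t + 1)"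
    and rate_j: "\<And>t. t \<ge> 0 \<Longrightarrow> norm (v j t - u') \<le> K / (t + 1)"
  shows "u \<noteq> u'"
proof
  assume "u = u'"
  define c where "c = 1 / dispersion_const n x v"
  define A where "A = norm (x i 0 - x j 0)"
  have "c > 0"
    by (simp add: c_def dispersion_const_pos)
  have bound: "c * t \<le> A + 2 * K * ln (t + 1)" if "t \<ge> 0" for t
  proof -
    have "x i t - x j t = (x i 0 - x j 0) + ((x i t - (x i 0 + t *\<^sub>R u)) - (x j t - (x j 0 + t *\<^sub>R u)))"
      by (simp add: algebra_simps)
    then have "norm (x i t - x j t)
        \<le> A + norm ((x i t - (x i 0 + t *\<^sub>R u)) - (x j t - (x j 0 + t *\<^sub>R u)))"
      unfolding A_def by (simp only: norm_triangle_ineq)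
    also have "\<dots> \<le> A + (norm (x i t - (x i 0 + t *\<^sub>R u)) + norm (x j t - (x j 0 + t *\<^sub>R u)))"
      by (intro add_left_mono norm_triangle_ineq4)
    also have "\<dots> \<le> A + (K * ln (t + 1) + K * ln (t + 1))"
      using rate_i rate_j that \<open>u = u'\<close>
      by (intro add_mono position_asymptotics[OF sol] ij) auto
    finally show ?thesis
      using distance_lower_bound[OF sol that ij] by (simp add: c_def)
  qed
  have "\<forall>\<^sub>F t in at_top. A + 2 * K * ln (t + 1) < c * t"
    using \<open>c > 0\<close> by real_asymp
  then have "\<forall>\<^sub>F t::real in at_top. False"
    using eventually_ge_at_top[of 0] by eventually_elim (use bound in fastforce)
  then show False by simp
qed

(* Constants depending only on the initial data: they serve every solution y, w of the
   system with the same initial data as x, v (in particular x, v itself). *)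
theorem mainTheorem2:
  fixes n :: nat and x v :: "nat \<Rightarrow> real \<Rightarrow> real ^ 3"
  assumes "n \<ge> 1" and "nbody_solution n x v"
  shows
    "(\<exists>C>0. \<forall>t\<ge>1. E_pot n x t \<le> C / t) \<and>
     (\<exists>c\<^sub>1>0. \<exists>c\<^sub>2>0. \<forall>y w. nbody_solution n y w \<longrightarrow> same_initial_data n x v y w \<longrightarrow>
        (\<forall>\<^sub>F t in at_top. \<forall>i\<in>{1..n}. \<forall>j\<in>{1..n}. i \<noteq> j \<longrightarrow>
           c\<^sub>1 * t \<le> norm (y i t - y j t) \<and> norm (y i t - y j t) \<le> c\<^sub>2 * t)) \<and>
     (\<exists>vstar :: nat \<Rightarrow> real ^ 3.
        (\<forall>i\<in>{1..n}. (v i \<longlongrightarrow> vstar i) at_top) \<and>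
        (\<exists>C>0. \<forall>t\<ge>1. \<forall>i\<in>{1..n}. norm (v i t - vstar i) \<le> C / t) \<and>
        (\<forall>i\<in>{1..n}. \<forall>j\<in>{1..n}. i \<noteq> j \<longrightarrow> vstar i \<noteq> vstar j) \<and>
        (\<exists>xstar :: nat \<Rightarrow> real ^ 3. \<forall>i\<in>{1..n}.
           (\<lambda>t. norm (x i t - (xstar i + t *\<^sub>R vstar i))) \<in> O[at_top](\<lambda>t. ln t)))"
proof -
  note sol = \<open>nbody_solution n x v\<close>
  define C where "C = dispersion_const n x v"
  define K where "K = force_const n x v"
  have "C > 0" and "K \<ge> 0"
    by (simp_all add: C_def K_def dispersion_const_pos force_const_nonneg)

  have a1: "\<exists>C>0. \<forall>t\<ge>1. E_pot n x t \<le> C / t"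
  proof (intro exI[of _ C] conjI allI impI)
    fix t :: real assume "t \<ge> 1"
    then have "E_pot n x t \<le> C / (t + 1)"
      unfolding C_def by (intro E_pot_decay'[OF sol]) simp
    also have "\<dots> \<le> C / t"
      using \<open>C > 0\<close> \<open>t \<ge> 1\<close> by (intro divide_left_mono) auto
    finally show "E_pot n x t \<le> C / t" .
  qed fact

  have a2: "\<exists>c\<^sub>1>0. \<exists>c\<^sub>2>0. \<forall>y w. nbody_solution n y w \<longrightarrow> same_initial_data n x v y w \<longrightarrow>
        (\<forall>\<^sub>F t in at_top. \<forall>i\<in>{1..n}. \<forall>j\<in>{1..n}. i \<noteq> j \<longrightarrow>
           c\<^sub>1 * t \<le> norm (y i t - y j t) \<and> norm (y i t - y j t) \<le> c\<^sub>2 * t)"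
  proof -
    define S where "S = (\<Sum>k\<in>{1..n}. norm (x k 0) + norm (v k 0))"
    define c2 where "c2 = 2 * (K + S) + 1"
    have "S \<ge> 0"
      unfolding S_def by (intro sum_nonneg) simp
    then have "c2 > 0"
      using \<open>K \<ge> 0\<close> by (simp add: c2_def)
    have "\<forall>\<^sub>F t in at_top. \<forall>i\<in>{1..n}. \<forall>j\<in>{1..n}. i \<noteq> j \<longrightarrow>
        1 / C * t \<le> norm (y i t - y j t) \<and> norm (y i t - y j t) \<le> c2 * t"
      if y: "nbody_solution n y w" and same: "same_initial_data n x v y w" for y w
      using eventually_ge_at_top[of 1]
    proof eventually_elim
      case (elim t)
      have C: "dispersion_const n y w = C" and K: "force_const n y w = K"
        by (simp_all add: C_def K_def force_const_def dispersion_const_cong[OF same])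
      have S: "(\<Sum>k\<in>{1..n}. norm (y k 0) + norm (w k 0)) = S"
        using same unfolding S_def same_initial_data_def by (intro sum.cong) auto
      have "norm (y i t - y j t) \<le> c2 * t" if "i \<in> {1..n}" "j \<in> {1..n}" for i j
        using distance_upper_bound[OF y elim that] elim unfolding K S
        by (simp add: c2_def algebra_simps)
      moreover have "1 / C * t \<le> norm (y i t - y j t)"
        if "i \<in> {1..n}" "j \<in> {1..n}" "i \<noteq> j" for i j
        using distance_lower_bound[OF y _ that, of t] elim unfolding C by simp
      ultimately show ?case by blast
    qed
    then show ?thesis
      using \<open>C > 0\<close> \<open>c2 > 0\<close> by (intro exI[of _ "1 / C"] exI[of _ c2] conjI) auto
  qed

  have "\<exists>u. (v i \<longlongrightarrow> u) at_top \<and> (\<forall>t\<ge>0. norm (v i t - u) \<le> K / (t + 1))"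
    if "i \<in> {1..n}" for i
    using velocity_converges[OF sol that] unfolding K_def by metis
  then obtain vstar where lim: "\<And>i. i \<in> {1..n} \<Longrightarrow> (v i \<longlongrightarrow> vstar i) at_top"
    and rate: "\<And>i t. i \<in> {1..n} \<Longrightarrow> t \<ge> 0 \<Longrightarrow> norm (v i t - vstar i) \<le> K / (t + 1)"
    by metis

  have b: "\<exists>C>0. \<forall>t\<ge>1. \<forall>i\<in>{1..n}. norm (v i t - vstar i) \<le> C / t"
  proof (intro exI[of _ "K + 1"] conjI allI impI ballI)
    fix t :: real and i assume "t \<ge> 1" "i \<in> {1..n}"
    then have "norm (v i t - vstar i) \<le> K / (t + 1)"
      by (intro rate) auto
    also have "\<dots> \<le> (K + 1) / t"
      using \<open>K \<ge> 0\<close> \<open>t \<ge> 1\<close> by (intro frac_le) auto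
    finally show "norm (v i t - vstar i) \<le> (K + 1) / t" .
  qed (use \<open>K \<ge> 0\<close> in simp)

  have distinct: "vstar i \<noteq> vstar j" if "i \<in> {1..n}" "j \<in> {1..n}" "i \<noteq> j" for i j
    using limiting_velocities_distinct[OF sol that rate rate] that by blast

  have c: "(\<lambda>t. norm (x i t - (x i 0 + t *\<^sub>R vstar i))) \<in> O[at_top](\<lambda>t. ln t)"
    if i: "i \<in> {1..n}" for i
  proof -
    have "(\<lambda>t. norm (x i t - (x i 0 + t *\<^sub>R vstar i))) \<in> O[at_top](\<lambda>t. K * ln (t + 1))"
    proof (rule bigoI[of _ 1])
      show "\<forall>\<^sub>F t in at_top. norm (norm (x i t - (x i 0 + t *\<^sub>R vstar i)))
          \<le> 1 * norm (K * ln (t + 1))"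
        using eventually_ge_at_top[of 0]
      proof eventually_elim
        case (elim t)
        then show ?case
          using position_asymptotics[OF sol i elim rate[OF i]] by simp
      qed
    qed
    also have "(\<lambda>t::real. K * ln (t + 1)) \<in> O[at_top](\<lambda>t. ln t)"
      by real_asymp
    finally show ?thesis .
  qed

  show ?thesis
    by (intro conjI a1 a2 exI[of _ vstar] b exI[of _ "\<lambda>i. x i 0"] ballI impI)
       (simp_all only: lim distinct c not_False_eq_True)
qed

end
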